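(* Let $T$ be a rank one automorphism of a standard Borel probability space obtained by the cutting-and-stacking construction with parameters $(r_n)_{n\in\mathbb{N}}$, $r_n\ge2$, and $(s^{(n)}_1,\ldots,s^{(n)}_{r_n})_{n\in\mathbb{N}}$, $s^{(n)}_i\ge0$ integers (such that the resulting invariant measure is finite). Suppose that there are an even integer $r\geq4$ and an increasing sequence $(n_k)_{k\in\mathbb{N}}$ such that: (i) $r_{n_k}=r$ for all $k$, and $r_{n_k+1}\to\infty$ as $k\to\infty$; (ii) $s^{(n_k)}_i=0$ for $1\le i\le r/2$ and $s^{(n_k)}_i=1$ for $r/2+1\leq i\leq r$; (iii) $s^{(n_k+1)}_i=0$ for $1\le i\le[r_{n_k+1}/2]$ and $s^{(n_k+1)}_i=1$ for $[r_{n_k+1}/2]+1\leq i\leq r_{n_k+1}$. Then $T$ is not reversible.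
   Context: Cutting-and-stacking (rank one) construction: one builds an increasing sequence of Rokhlin towers $C_n=\{C_{n,1},\ldots,C_{n,q_n}\}$ of pairwise disjoint intervals (levels) of equal length, where $T$ maps $C_{n,j}$ linearly onto $C_{n,j+1}$ for $1\le j<q_n$. To get $C_{n+1}$, cut $C_n$ into $r_n$ subcolumns $C_n(1),\ldots,C_n(r_n)$ of equal width (numbered left to right), place $s^{(n)}_i$ additional intervals (spacers) of the same width over the subcolumn $C_n(i)$, and stack: $T$ maps the top level of $C_n(i)$ linearly to the first spacer over it, each spacer to the one above, and the top spacer over $C_n(i)$ (or the top level of $C_n(i)$ itself if $s^{(n)}_i=0$) to the bottom level of $C_n(i+1)$, for $1\le i<r_n$, ending at the top of the column over $C_n(r_n)$. So $q_{n+1}=r_nq_n+\sum_{i=1}^{r_n}s^{(n)}_i$. In the limit this defines $T$ a.e. on the union of all levels; the invariant measure is Lebesgue measure, assumed finite and normalized to be a probability measure. $[\cdot]$ is the integer part. An automorphism $T$ is reversible if there is an invertible measure-preserving $S$ with $T\circ S=S\circ T^{-1}$ and $S^2=\mathrm{Id}$. *)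

theory Defs
  imports "HOL-Probability.Probability"
begin

definition measure_preserving_map :: "'a measure \<Rightarrow> ('a \<Rightarrow> 'a) \<Rightarrow> bool" where
  "measure_preserving_map M T \<longleftrightarrow> T \<in> measurable M M \<and> distr M M T = M"

text \<open>As usual in ergodic theory, invertibility and all identities between maps are meant
  modulo null sets.\<close>

definition mutually_inverse_mod0 :: "'a measure \<Rightarrow> ('a \<Rightarrow> 'a) \<Rightarrow> ('a \<Rightarrow> 'a) \<Rightarrow> bool" where
  "mutually_inverse_mod0 M T T' \<longleftrightarrow>
     measure_preserving_map M T \<and> measure_preserving_map M T' \<and>
     (AE x in M. T' (T x) = x) \<and> (AE x in M. T (T' x) = x)"

definition automorphism :: "'a measure \<Rightarrow> ('a \<Rightarrow> 'a) \<Rightarrow> bool" where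
  "automorphism M T \<longleftrightarrow> (\<exists>T'. mutually_inverse_mod0 M T T')"

text \<open>The map \<open>T'\<close> below is the inverse of \<open>T\<close>; it is unique up to null sets.\<close>

definition reversible :: "'a measure \<Rightarrow> ('a \<Rightarrow> 'a) \<Rightarrow> bool" where
  "reversible M T \<longleftrightarrow>
     (\<exists>T' S. mutually_inverse_mod0 M T T' \<and> automorphism M S \<and>
             (AE x in M. T (S x) = S (T' x)) \<and> (AE x in M. S (S x) = x))"

text \<open>Tower number \<open>n\<close> has \<open>q n\<close> levels, numbered \<open>1, \<dots>, q n\<close> from bottom to top. Level \<open>j\<close>
  is a half-open interval with left end point \<open>a n j\<close> and length \<open>w n\<close>.\<close>

definition level :: "(nat \<Rightarrow> nat \<Rightarrow> real) \<Rightarrow> (nat \<Rightarrow> real) \<Rightarrow> nat \<Rightarrow> nat \<Rightarrow> real set" where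
  "level a w n j = {a n j ..< a n j + w n}"

text \<open>The number of levels of tower \<open>n + 1\<close> lying below subcolumn \<open>i\<close> of tower \<open>n\<close>: all
  preceding subcolumns together with the spacers above them.\<close>

definition levels_below :: "(nat \<Rightarrow> nat \<Rightarrow> nat) \<Rightarrow> (nat \<Rightarrow> nat) \<Rightarrow> nat \<Rightarrow> nat \<Rightarrow> nat" where
  "levels_below s q n i = (\<Sum>l\<in>{1..<i}. q n + s n l)"

text \<open>Here \<open>r n\<close> is the number of subcolumns into which tower \<open>n\<close> is cut, and \<open>s n i\<close>
  (\<open>1 \<le> i \<le> r n\<close>) is the number of spacers put over its \<open>i\<close>-th subcolumn. The last condition says
  that the levels of tower \<open>n + 1\<close> with numbers \<open>levels_below s q n i + j\<close>, \<open>1 \<le> j \<le> q n\<close>, are,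
  from bottom to top, the levels of the \<open>i\<close>-th subcolumn of tower \<open>n\<close>. The remaining levels of
  tower \<open>n + 1\<close>, with numbers \<open>levels_below s q n i + q n + m\<close>, \<open>1 \<le> m \<le> s n i\<close>, are the spacers.
  They may be placed anywhere on the line; as these subcolumns exhaust tower \<open>n\<close>, disjointness of
  the levels of tower \<open>n + 1\<close> forces the spacers to be disjoint from tower \<open>n\<close>.\<close>

definition cutting_and_stacking ::
  "(nat \<Rightarrow> nat) \<Rightarrow> (nat \<Rightarrow> nat \<Rightarrow> nat) \<Rightarrow> (nat \<Rightarrow> nat) \<Rightarrow> (nat \<Rightarrow> nat \<Rightarrow> real) \<Rightarrow> (nat \<Rightarrow> real) \<Rightarrow> bool"
where
  "cutting_and_stacking r s q a w \<longleftrightarrow>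
     1 \<le> q 0 \<and> 0 < w 0 \<and>
     (\<forall>n. q (Suc n) = r n * q n + (\<Sum>i=1..r n. s n i)) \<and>
     (\<forall>n. w (Suc n) = w n / real (r n)) \<and>
     (\<forall>n. disjoint_family_on (level a w n) {1..q n}) \<and>
     (\<forall>n. \<forall>i\<in>{1..r n}. \<forall>j\<in>{1..q n}.
        a (Suc n) (levels_below s q n i + j) = a n j + (real i - 1) * w (Suc n))"

definition tower_union :: "(nat \<Rightarrow> nat) \<Rightarrow> (nat \<Rightarrow> nat \<Rightarrow> real) \<Rightarrow> (nat \<Rightarrow> real) \<Rightarrow> real set" where
  "tower_union q a w = (\<Union>n. \<Union>j\<in>{1..q n}. level a w n j)"

text \<open>The condition \<open>prob_space M\<close> combines finiteness of the invariant measure with its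
  normalization, as \<open>w 0\<close> is free. The last condition says that \<open>T\<close> maps every level
  except the top one linearly onto the next level.\<close>

definition rank_one_automorphism ::
  "(nat \<Rightarrow> nat) \<Rightarrow> (nat \<Rightarrow> nat \<Rightarrow> nat) \<Rightarrow> real measure \<Rightarrow> (real \<Rightarrow> real) \<Rightarrow> bool"
where
  "rank_one_automorphism r s M T \<longleftrightarrow>
     (\<exists>q a w. cutting_and_stacking r s q a w \<and>
        M = restrict_space lborel (tower_union q a w) \<and> prob_space M \<and>
        automorphism M T \<and>
        (AE x in M. \<forall>n. \<forall>j\<in>{1..<q n}. x \<in> level a w n j \<longrightarrow> T x = x + (a n (Suc j) - a n j)))"

end

theory Submission
  imports Defs
begin

text \<open>Let \<open>n = nk k\<close> and consider a point of tower \<open>n\<close>. The numbers of spacers \<open>c, c'\<close> met during its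
  first two returns to its level are read off the periodic sequence \<open>0\<dots>01\<dots>1\<close> or \<open>0\<dots>01\<dots>12\<close> of
  length \<open>R\<close>, each with probability about one half. As \<open>R \<ge> 4\<close>, the pair \<open>(c, c') = (1, 2)\<close> occurs with
  probability bounded below, while \<open>(2, 1)\<close> occurs only with vanishing probability. If \<open>E\<close> is disjoint
  from \<open>T E\<close> and \<open>T (T E)\<close>, it follows that the set of points of \<open>E\<close> that are in \<open>E\<close> at the times \<open>q n + 1\<close>
  and \<open>2 q n + 3\<close> has measure bounded below. If \<open>S\<close> conjugates \<open>T\<close> to its inverse, this set has the same measure
  as the set of points of \<open>F = S\<inverse> E\<close> that are in \<open>F\<close> at the times \<open>q n + 2\<close> and \<open>2 q n + 3\<close>. But \<open>F\<close> too is
  disjoint from its first two translates, so such visits force \<open>(c, c') = (2, 1)\<close> up to the error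
  of approximating \<open>F\<close> by levels, and the measure of the latter set tends to zero.\<close>

section \<open>Maps preserving a measure\<close>

lemma measure_preserving_mapD:
  assumes "measure_preserving_map M S"
  shows "S \<in> measurable M M" and "distr M M S = M"
  using assms by (auto simp: measure_preserving_map_def)

lemma measure_preserving_map_AE:
  assumes "measure_preserving_map M S" and "AE x in M. P x"
  shows "AE x in M. P (S x)"
proof (rule AE_distrD[OF measure_preserving_mapD(1)[OF assms(1)]])
  show "AE x in distr M M S. P x"
    unfolding measure_preserving_mapD(2)[OF assms(1)] by (rule assms(2))
qed

lemma measure_preserving_map_vimage_in_sets:
  assumes "measure_preserving_map M S" and "A \<in> sets M"
  shows "{x \<in> space M. S x \<in> A} \<in> sets M"
  using measurable_sets[OF measure_preserving_mapD(1)[OF assms(1)] assms(2)]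
  by (simp add: vimage_def Int_def conj_commute)

lemma measure_preserving_map_vimage:
  assumes "measure_preserving_map M S" and "A \<in> sets M"
  shows "measure M {x \<in> space M. S x \<in> A} = measure M A"
proof -
  have "measure M A = measure (distr M M S) A"
    unfolding measure_preserving_mapD(2)[OF assms(1)] ..
  also have "\<dots> = measure M (S -` A \<inter> space M)"
    by (rule measure_distr[OF measure_preserving_mapD(1)[OF assms(1)] assms(2)])
  finally show ?thesis
    by (simp add: vimage_def Int_def conj_commute)
qed

lemma measure_preserving_map_compose:
  assumes "measure_preserving_map M S" and "measure_preserving_map M S'"
  shows "measure_preserving_map M (\<lambda>x. S (S' x))"
  using assms distr_distr[of S M M S' M]
  by (auto simp: measure_preserving_map_def comp_def)

lemma measure_preserving_map_funpow:
  assumes "measure_preserving_map M S"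
  shows "measure_preserving_map M (S ^^ n)"
proof (induction n)
  case 0
  show ?case by (simp add: measure_preserving_map_def id_def distr_id)
next
  case (Suc n)
  then show ?case
    using measure_preserving_map_compose[OF assms Suc] by (simp add: comp_def)
qed

lemma interval_subdivide:
  fixes x b v :: real
  assumes "0 < v" "x \<in> {b ..< b + real k * v}"
  shows "\<exists>i\<in>{1..k}. x \<in> {b + (real i - 1) * v ..< b + real i * v}"
  using assms(2)
proof (induction k)
  case (Suc k)
  show ?case
  proof (cases "x < b + real k * v")
    case True
    then obtain i where "i \<in> {1..k}" "x \<in> {b + (real i - 1) * v ..< b + real i * v}"
      using Suc by auto
    then show ?thesis by (intro bexI[of _ i]) auto
  next
    case False
    then show ?thesis using Suc.prems by (intro bexI[of _ "Suc k"]) auto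
  qed
qed simp

section \<open>Geometry of the towers\<close>

locale rank_one = prob_space M
  for M :: "real measure"
    and r :: "nat \<Rightarrow> nat" and s :: "nat \<Rightarrow> nat \<Rightarrow> nat" and q :: "nat \<Rightarrow> nat"
    and a :: "nat \<Rightarrow> nat \<Rightarrow> real" and w :: "nat \<Rightarrow> real" and T :: "real \<Rightarrow> real" +
  assumes r_ge_2: "2 \<le> r n"
    and cutting_and_stacking: "cutting_and_stacking r s q a w"
    and M_eq: "M = restrict_space lborel (tower_union q a w)"
    and T_mp: "measure_preserving_map M T"
    and T_level: "AE x in M. \<forall>n. \<forall>j\<in>{1..<q n}. x \<in> level a w n j \<longrightarrow>
      T x = x + (a n (Suc j) - a n j)"
begin

abbreviation lev :: "nat \<Rightarrow> nat \<Rightarrow> real set" where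
  "lev \<equiv> level a w"

abbreviation below :: "nat \<Rightarrow> nat \<Rightarrow> nat" where
  "below \<equiv> levels_below s q"

lemma q_Suc: "q (Suc n) = r n * q n + (\<Sum>i=1..r n. s n i)"
  and w_Suc: "w (Suc n) = w n / real (r n)"
  and lev_disjoint: "disjoint_family_on (lev n) {1..q n}"
  and a_Suc: "i \<in> {1..r n} \<Longrightarrow> j \<in> {1..q n} \<Longrightarrow>
    a (Suc n) (below n i + j) = a n j + (real i - 1) * w (Suc n)"
  using cutting_and_stacking by (auto simp: cutting_and_stacking_def)

lemma q_pos: "1 \<le> q n"
proof (induction n)
  case 0
  show ?case using cutting_and_stacking by (simp add: cutting_and_stacking_def)
next
  case (Suc n)
  then have "1 * 1 \<le> r n * q n" using r_ge_2[of n] by (intro mult_le_mono) auto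
  then show ?case unfolding q_Suc by linarith
qed

lemma w_pos: "0 < w n"
proof (induction n)
  case 0
  show ?case using cutting_and_stacking by (simp add: cutting_and_stacking_def)
next
  case (Suc n)
  then show ?case using r_ge_2[of n] by (simp add: w_Suc)
qed

lemma w_eq: "w n = real (r n) * w (Suc n)"
  using r_ge_2[of n] by (simp add: w_Suc)

lemma w_tendsto_0: "w \<longlonglongrightarrow> 0"
proof (rule tendsto_sandwich[OF _ _ tendsto_const])
  \<comment> \<open>Each tower is cut into at least two subcolumns, so every stage at least halves
    the width.\<close>
  have "w n \<le> w 0 * (1 / 2) ^ n" for n
  proof (induction n)
    case (Suc n)
    have "w (Suc n) \<le> w n / 2"
      unfolding w_Suc using r_ge_2[of n] w_pos[of n] by (intro divide_left_mono) auto
    with Suc show ?case by simp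
  qed simp
  then show "\<forall>\<^sub>F n in sequentially. w n \<le> w 0 * (1 / 2) ^ n" by simp
  show "(\<lambda>n. w 0 * (1 / 2) ^ n) \<longlonglongrightarrow> 0"
    by (intro tendsto_mult_right_zero LIMSEQ_power_zero) auto
qed (use w_pos in \<open>simp add: less_imp_le\<close>)

lemma q_ge_power: "2 ^ n \<le> q n"
proof (induction n)
  case 0
  show ?case using q_pos by simp
next
  case (Suc n)
  have "2 * q n \<le> r n * q n" by (rule mult_le_mono1[OF r_ge_2])
  with Suc show ?case unfolding q_Suc power_Suc by linarith
qed

lemma below_1: "below n (Suc 0) = 0"
  by (simp add: levels_below_def)

lemma below_Suc: "1 \<le> i \<Longrightarrow> below n (Suc i) = below n i + q n + s n i"
  by (simp add: levels_below_def)

lemma q_eq_below: "q (Suc n) = below n (r n) + q n + s n (r n)"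
proof -
  have "q (Suc n) = below n (Suc (r n))"
    by (simp add: q_Suc levels_below_def sum.distrib atLeastLessThanSuc_atLeastAtMost)
  then show ?thesis using below_Suc[of "r n" n] r_ge_2[of n] by simp
qed

lemma below_mono: "i \<le> i' \<Longrightarrow> below n i \<le> below n i'"
  unfolding levels_below_def by (rule sum_mono2) auto

lemma below_bounds:
  assumes "i \<in> {1..r n}" "j \<in> {1..q n}"
  shows "below n i + j \<in> {1..q (Suc n)}"
  using assms below_mono[of i "r n" n] q_eq_below[of n] by auto

lemma lev_Suc:
  assumes "i \<in> {1..r n}" "j \<in> {1..q n}"
  shows "lev (Suc n) (below n i + j) =
    {a n j + (real i - 1) * w (Suc n) ..< a n j + real i * w (Suc n)}"
  using a_Suc[OF assms] by (auto simp: level_def algebra_simps)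

lemma lev_Suc_subset:
  assumes "i \<in> {1..r n}" "j \<in> {1..q n}"
  shows "lev (Suc n) (below n i + j) \<subseteq> lev n j"
proof -
  have "real i * w (Suc n) \<le> w n" "0 \<le> (real i - 1) * w (Suc n)"
    using assms w_pos[of "Suc n"] by (auto simp: w_eq[of n])
  then show ?thesis
    using w_pos[of "Suc n"] unfolding lev_Suc[OF assms] unfolding level_def
    by (auto simp: algebra_simps)
qed

text \<open>Cutting discards nothing: the subcolumns tile each level from left to right. Hence a
  point of one tower lies in all later towers.\<close>

lemma lev_cover:
  assumes "x \<in> lev n j" "j \<in> {1..q n}"
  shows "\<exists>i\<in>{1..r n}. x \<in> lev (Suc n) (below n i + j)"
proof -
  have "x \<in> {a n j ..< a n j + real (r n) * w (Suc n)}"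
    using assms by (simp add: level_def w_eq[of n])
  from interval_subdivide[OF w_pos this] obtain i
    where "i \<in> {1..r n}" "x \<in> {a n j + (real i - 1) * w (Suc n) ..< a n j + real i * w (Suc n)}"
    by auto
  with lev_Suc[OF this(1) assms(2)] show ?thesis by (intro bexI[of _ i]) simp_all
qed

section \<open>Measure of unions of levels, and approximation by them\<close>

lemma tower_union_borel: "tower_union q a w \<in> sets borel"
  by (auto simp: tower_union_def level_def)

lemma space_M: "space M = tower_union q a w"
  by (subst M_eq) (simp add: space_restrict_space)

lemma sets_M_iff: "A \<in> sets M \<longleftrightarrow> A \<in> sets borel \<and> A \<subseteq> space M"
  unfolding space_M by (subst M_eq, subst sets_restrict_space_iff)
    (use tower_union_borel in auto)

lemma emeasure_M: "A \<subseteq> space M \<Longrightarrow> emeasure M A = emeasure lborel A"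
  unfolding space_M
  by (subst M_eq, subst emeasure_restrict_space) (use tower_union_borel in auto)

lemma interval_in_sets:
  assumes "{b ..< c} \<subseteq> lev n j" "j \<in> {1..q n}"
  shows "{b ..< c} \<in> sets M"
proof -
  have "lev n j \<subseteq> space M" using assms(2) unfolding space_M tower_union_def by blast
  with assms(1) show ?thesis by (auto simp: sets_M_iff)
qed

lemma measure_interval:
  assumes "{b ..< c} \<subseteq> lev n j" "j \<in> {1..q n}" "b \<le> c"
  shows "measure M {b ..< c} = c - b"
proof -
  have "{b ..< c} \<subseteq> space M"
    using interval_in_sets[OF assms(1,2)] sets_M_iff by blast
  from emeasure_M[OF this] show ?thesis using assms(3) by (simp add: measure_def)
qed

lemma lev_in_sets: "j \<in> {1..q n} \<Longrightarrow> lev n j \<in> sets M"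
  using interval_in_sets[of "a n j" "a n j + w n" n j] by (simp add: level_def)

lemma measure_lev: "j \<in> {1..q n} \<Longrightarrow> measure M (lev n j) = w n"
  using measure_interval[of "a n j" "a n j + w n" n j] w_pos[of n] by (simp add: level_def)

lemma UN_lev_in_sets: "J \<subseteq> {1..q n} \<Longrightarrow> (\<Union>j\<in>J. lev n j) \<in> sets M"
  using lev_in_sets by (intro sets.finite_UN) (auto intro: finite_subset)

text \<open>Disjointness is inherited from the levels. Subintervals are allowed because the lower
  bound for the returns uses only a piece of each level.\<close>

lemma measure_UN_intervals:
  assumes "J \<subseteq> {1..q n}" "\<And>j. j \<in> J \<Longrightarrow> {b j ..< b j + v} \<subseteq> lev n j" "0 \<le> v"
  shows "measure M (\<Union>j\<in>J. {b j ..< b j + v}) = real (card J) * v"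
proof -
  have "measure M (\<Union>j\<in>J. {b j ..< b j + v}) = (\<Sum>j\<in>J. measure M {b j ..< b j + v})"
  proof (rule finite_measure_finite_Union)
    show "finite J" using assms(1) by (rule finite_subset) simp
    show "(\<lambda>j. {b j ..< b j + v}) ` J \<subseteq> sets M"
      using interval_in_sets assms by blast
    show "disjoint_family_on (\<lambda>j. {b j ..< b j + v}) J"
      using lev_disjoint[of n] assms(1,2) unfolding disjoint_family_on_def by blast
  qed
  also have "\<dots> = (\<Sum>j\<in>J. v)"
    by (intro sum.cong refl) (use measure_interval[OF assms(2)] assms in auto)
  finally show ?thesis by simp
qed

lemma measure_UN_lev:
  assumes "J \<subseteq> {1..q n}"
  shows "measure M (\<Union>j\<in>J. lev n j) = real (card J) * w n"
  using measure_UN_intervals[OF assms, of "a n" "w n"] w_pos[of n] by (simp add: level_def)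

text \<open>Outer regularity provides an open \<open>U\<close> around \<open>F\<close> with little
  excess. The levels contained in \<open>U\<close> fill up \<open>U\<close> within the space,
  because towers refine each other and widths tend to zero. The bound holds for all large
  \<open>n\<close>, and so along any subsequence of towers.\<close>

lemma approx_by_levels:
  assumes F: "F \<in> sets M" and "0 < e"
  shows "\<forall>\<^sub>F n in sequentially. \<exists>J\<subseteq>{1..q n}.
    measure M (F - (\<Union>j\<in>J. lev n j)) < e \<and> measure M ((\<Union>j\<in>J. lev n j) - F) < e"
proof -
  obtain U where U: "open U" "F \<subseteq> U" "emeasure lborel (U - F) < e"
    using outer_regular_lborel[of F e] F \<open>0 < e\<close> by (auto simp: sets_M_iff)
  define J where "J n = {j \<in> {1..q n}. lev n j \<subseteq> U}" for n
  define V where "V n = (\<Union>j\<in>J n. lev n j)" for n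
  have V_sets: "V n \<in> sets M" for n
    unfolding V_def by (rule UN_lev_in_sets) (auto simp: J_def)
  have V_space: "V n \<subseteq> space M" for n
    using V_sets sets.sets_into_space by blast
  have US: "U \<inter> space M \<in> sets M"
    using U(1) tower_union_borel by (auto simp: sets_M_iff space_M)
  have "incseq V"
  proof (rule incseq_SucI, rule subsetI)
    fix n x assume "x \<in> V n"
    then obtain j where j: "j \<in> {1..q n}" "lev n j \<subseteq> U" "x \<in> lev n j"
      by (auto simp: V_def J_def)
    from lev_cover[OF j(3,1)] obtain i where
      i: "i \<in> {1..r n}" "x \<in> lev (Suc n) (below n i + j)" by blast
    then show "x \<in> V (Suc n)"
      using below_bounds[OF i(1) j(1)] lev_Suc_subset[OF i(1) j(1)] j(2)
      by (auto simp: V_def J_def intro!: bexI[of _ "below n i + j"])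
  qed
  moreover have "(\<Union>n. V n) = U \<inter> space M"
  proof (intro equalityI subsetI)
    fix x assume "x \<in> (\<Union>n. V n)"
    then show "x \<in> U \<inter> space M"
      using V_space by (auto simp: V_def J_def)
  next
    fix x assume x: "x \<in> U \<inter> space M"
    then obtain n0 where n0: "\<exists>j\<in>{1..q n0}. x \<in> lev n0 j"
      by (auto simp: space_M tower_union_def)
    have tower: "\<exists>j\<in>{1..q n}. x \<in> lev n j" if "n0 \<le> n" for n
      using that
    proof (induction n rule: dec_induct)
      case base
      show ?case by (rule n0)
    next
      case (step n)
      then obtain j where j: "j \<in> {1..q n}" "x \<in> lev n j" by blast
      from lev_cover[OF j(2,1)] obtain i where
        "i \<in> {1..r n}" "x \<in> lev (Suc n) (below n i + j)" by blast
      with below_bounds[OF _ j(1)] show ?case by blast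
    qed
    obtain d where d: "0 < d" "ball x d \<subseteq> U"
      using U(1) x open_contains_ball by blast
    have "\<forall>\<^sub>F n in sequentially. w n < d"
      using order_tendstoD(2)[OF w_tendsto_0 d(1)] .
    then have "\<forall>\<^sub>F n in sequentially. n0 \<le> n \<and> w n < d"
      using eventually_ge_at_top[of n0] by eventually_elim simp
    then obtain n where n: "n0 \<le> n" "w n < d"
      using eventually_happens trivial_limit_sequentially by blast
    obtain j where j: "j \<in> {1..q n}" "x \<in> lev n j" using tower[OF n(1)] by blast
    \<comment> \<open>A level containing \<open>x\<close> has length \<open>w n < d\<close>, so it
      cannot leave the ball.\<close>
    have "lev n j \<subseteq> ball x d"
      using j(2) n(2) by (auto simp: level_def dist_real_def)
    with j d(2) have "x \<in> V n" by (auto simp: V_def J_def)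
    then show "x \<in> (\<Union>n. V n)" by blast
  qed
  ultimately have "(\<lambda>n. measure M (V n)) \<longlonglongrightarrow> measure M (U \<inter> space M)"
    using finite_Lim_measure_incseq[of V] V_sets by auto
  then have "\<forall>\<^sub>F n in sequentially. measure M (U \<inter> space M) - e < measure M (V n)"
    by (rule order_tendstoD) (use \<open>0 < e\<close> in simp)
  then show ?thesis
  proof eventually_elim
    case (elim n)
    have VU: "V n \<subseteq> U \<inter> space M" using V_space by (auto simp: V_def J_def)
    have "measure M (F - V n) \<le> measure M (U \<inter> space M - V n)"
      using U(2) F US V_sets sets.sets_into_space[OF F] by (intro finite_measure_mono) auto
    also have "\<dots> = measure M (U \<inter> space M) - measure M (V n)"
      using finite_measure_Diff[OF US V_sets VU] .
    finally have 1: "measure M (F - V n) < e" using elim by simp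
    have "V n - F \<in> sets M" using V_sets F by blast
    then have "emeasure M (V n - F) = emeasure lborel (V n - F)"
      by (intro emeasure_M) (simp add: sets_M_iff)
    also have "\<dots> \<le> emeasure lborel (U - F)"
      using VU U(1) F by (intro emeasure_mono) (auto simp: sets_M_iff)
    finally have "emeasure M (V n - F) < e" using U(3) by simp
    then have 2: "measure M (V n - F) < e"
      using \<open>0 < e\<close> by (simp add: emeasure_eq_measure ennreal_less_iff)
    show ?case
      using 1 2 by (intro exI[of _ "J n"]) (auto simp: V_def J_def)
  qed
qed

section \<open>Orbits climbing the towers\<close>

definition regular_orbit :: "real \<Rightarrow> bool" where
  "regular_orbit x \<longleftrightarrow>
    (\<forall>n j m. 1 \<le> j \<longrightarrow> j + m \<le> q n \<longrightarrow> x \<in> lev n j \<longrightarrow> (T ^^ m) x \<in> lev n (j + m))"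

text \<open>The rule for \<open>T\<close> on levels is pulled back along every power of
  \<open>T\<close>, at the cost of countably many null sets. Later arguments can then follow the
  orbit of one fixed point through all towers.\<close>

lemma AE_regular_orbit: "AE x in M. regular_orbit x"
proof -
  have "AE x in M. \<forall>i. \<forall>n. \<forall>j\<in>{1..<q n}. (T ^^ i) x \<in> lev n j \<longrightarrow>
      T ((T ^^ i) x) = (T ^^ i) x + (a n (Suc j) - a n j)"
    by (subst AE_all_countable)
      (intro allI measure_preserving_map_AE[OF measure_preserving_map_funpow[OF T_mp] T_level])
  then show ?thesis
  proof eventually_elim
    case (elim x)
    have "(T ^^ m) x \<in> lev n (j + m)" if "1 \<le> j" "j + m \<le> q n" "x \<in> lev n j" for n j m
      using that(2)
    proof (induction m)
      case 0
      show ?case using that by simp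
    next
      case (Suc m)
      then have *: "(T ^^ m) x \<in> lev n (j + m)" by simp
      have "T ((T ^^ m) x) = (T ^^ m) x + (a n (Suc (j + m)) - a n (j + m))"
        using elim * Suc.prems that(1) by simp
      then show ?case using * by (simp add: level_def)
    qed
    then show ?case unfolding regular_orbit_def by blast
  qed
qed

lemma vimage_funpow_in_sets:
  "A \<in> sets M \<Longrightarrow> {x \<in> space M. (T ^^ m) x \<in> A} \<in> sets M"
  by (rule measure_preserving_map_vimage_in_sets[OF measure_preserving_map_funpow[OF T_mp]])

lemma AE_funpow: "AE x in M. P x \<Longrightarrow> AE x in M. \<forall>m. P ((T ^^ m) x)"
  by (subst AE_all_countable)
    (intro allI measure_preserving_map_AE[OF measure_preserving_map_funpow[OF T_mp]])

lemma measure_vimage_funpow: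
  "A \<in> sets M \<Longrightarrow> measure M {x \<in> space M. (T ^^ m) x \<in> A} = measure M A"
  by (rule measure_preserving_map_vimage[OF measure_preserving_map_funpow[OF T_mp]])

section \<open>Returns of a point to its level\<close>

lemma triple_returns_in_sets:
  assumes "A \<in> sets M"
  shows "{x \<in> space M. x \<in> A \<and> (T ^^ m) x \<in> A \<and> (T ^^ m') x \<in> A} \<in> sets M"
proof -
  have "{x \<in> space M. x \<in> A \<and> (T ^^ m) x \<in> A \<and> (T ^^ m') x \<in> A} =
      A \<inter> {x \<in> space M. (T ^^ m) x \<in> A} \<inter> {x \<in> space M. (T ^^ m') x \<in> A}"
    using sets.sets_into_space[OF assms] by auto
  then show ?thesis using vimage_funpow_in_sets[OF assms] assms by (simp only: sets.Int)
qed

text \<open>The number in tower \<open>n + 2\<close> of the copy of level \<open>j\<close> of tower \<open>n\<close> in subcolumn \<open>i\<close> of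
  tower \<open>n\<close> and subcolumn \<open>i'\<close> of tower \<open>n + 1\<close>.\<close>

abbreviation pos :: "nat \<Rightarrow> nat \<Rightarrow> nat \<Rightarrow> nat \<Rightarrow> nat" where
  "pos n i' i j \<equiv> below (Suc n) i' + (below n i + j)"

lemma pos_bounds:
  assumes "i' \<in> {1..r (Suc n)}" "i \<in> {1..r n}" "j \<in> {1..q n}"
  shows "pos n i' i j \<in> {1..q (Suc (Suc n))}"
  using below_bounds[OF assms(1) below_bounds[OF assms(2,3)]] .

lemma lev_pos_subset:
  assumes "i' \<in> {1..r (Suc n)}" "i \<in> {1..r n}" "j \<in> {1..q n}"
  shows "lev (Suc (Suc n)) (pos n i' i j) \<subseteq> lev n j"
  using lev_Suc_subset[OF assms(1) below_bounds[OF assms(2,3)]] lev_Suc_subset[OF assms(2,3)]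
  by (rule order_trans)

text \<open>For fixed \<open>i\<close> and \<open>j\<close> the copies with consecutive
  \<open>i'\<close> are adjacent intervals, so a run of them is again an interval.\<close>

lemma lev_pos_eq:
  assumes "i' \<in> {1..r (Suc n)}" "i \<in> {1..r n}" "j \<in> {1..q n}"
  shows "lev (Suc (Suc n)) (pos n i' i j) =
    {a n j + (real i - 1) * w (Suc n) + (real i' - 1) * w (Suc (Suc n)) ..<
     a n j + (real i - 1) * w (Suc n) + real i' * w (Suc (Suc n))}"
  using lev_Suc[OF assms(1) below_bounds[OF assms(2,3)]] a_Suc[OF assms(2,3)] by simp

lemma lev_pos_cover:
  assumes "x \<in> lev n j" "j \<in> {1..q n}"
  obtains i' i where "i' \<in> {1..r (Suc n)}" "i \<in> {1..r n}"
    "x \<in> lev (Suc (Suc n)) (pos n i' i j)"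
  using lev_cover[OF assms] lev_cover[OF _ below_bounds[OF _ assms(2)]] by metis

lemma pos_Suc: "1 \<le> i \<Longrightarrow> pos n i' (Suc i) j = pos n i' i j + (q n + s n i)"
  by (simp add: below_Suc)

text \<open>Above the last subcolumn of tower \<open>n\<close> the spacers of both stages are
  stacked on each other, so their numbers add. In the blocks studied below this is how two spacers
  arise between consecutive copies.\<close>

lemma pos_top:
  "1 \<le> i' \<Longrightarrow> pos n (Suc i') 1 j = pos n i' (r n) j + (q n + s n (r n) + s (Suc n) i')"
  using below_Suc[of i' "Suc n"] q_eq_below[of n] by (simp add: below_1)

text \<open>Both copies of level \<open>j\<close> lie in tower \<open>n + 2\<close>, so the orbit
  climbs from one to the other without leaving that tower.\<close>

lemma return_same_level:
  assumes "regular_orbit x" "x \<in> lev (Suc (Suc n)) (pos n i' i j)"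
    and "i' \<in> {1..r (Suc n)}" "i \<in> {1..r n}" "j \<in> {1..q n}"
    and "k' \<in> {1..r (Suc n)}" "k \<in> {1..r n}" "pos n k' k j = pos n i' i j + m"
  shows "(T ^^ m) x \<in> lev n j"
proof -
  have "(T ^^ m) x \<in> lev (Suc (Suc n)) (pos n i' i j + m)"
    using assms(1,2) pos_bounds[OF assms(3-5)] pos_bounds[OF assms(6,7,5)] assms(8)
    unfolding regular_orbit_def by auto
  then show ?thesis using lev_pos_subset[OF assms(6,7,5)] assms(8) by auto
qed

section \<open>Separated sets and time reversal\<close>

lemma exists_disjoint_translates:
  obtains E where "E \<in> sets M" "0 < measure M E"
    "AE x in M. \<not> (x \<in> E \<and> T x \<in> E)" "AE x in M. \<not> (x \<in> E \<and> T (T x) \<in> E)"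
proof
  \<comment> \<open>The set is the bottom level of tower 2; with at least three levels there, its
    first two translates are other levels.\<close>
  have q2: "3 \<le> q 2" using q_ge_power[of 2] by simp
  have one: "1 \<in> {1..q 2}" using q2 by simp
  show "lev 2 1 \<in> sets M" "0 < measure M (lev 2 1)"
    using lev_in_sets[OF one] measure_lev[OF one] w_pos[of 2] by auto
  have "AE x in M. \<forall>m\<in>{1, 2}. \<not> (x \<in> lev 2 1 \<and> (T ^^ m) x \<in> lev 2 1)"
    using AE_regular_orbit
  proof eventually_elim
    case (elim x)
    show ?case
    proof (intro ballI notI)
      fix m :: nat
      assume m: "m \<in> {1, 2}" and x: "x \<in> lev 2 1 \<and> (T ^^ m) x \<in> lev 2 1"
      have "1 + m \<le> q 2" using q2 m by auto
      with elim x have "(T ^^ m) x \<in> lev 2 (1 + m)" unfolding regular_orbit_def by blast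
      moreover have "lev 2 1 \<inter> lev 2 (1 + m) = {}"
        using \<open>1 + m \<le> q 2\<close> m by (intro disjoint_family_onD[OF lev_disjoint]) auto
      ultimately show False using x by blast
    qed
  qed
  then show "AE x in M. \<not> (x \<in> lev 2 1 \<and> T x \<in> lev 2 1)"
    "AE x in M. \<not> (x \<in> lev 2 1 \<and> T (T x) \<in> lev 2 1)"
    by (eventually_elim, simp add: numeral_2_eq_2)+
qed

text \<open>Each factor \<open>T\<close> on the left cancels one on the right, at the point
  \<open>(T ^^ b) x\<close>. This form of the conjugacy involves no inverse of
  \<open>T\<close>.\<close>

lemma AE_reversed_funpow:
  assumes "AE x in M. T (S (T x)) = S x"
  shows "AE x in M. \<forall>m b. (T ^^ m) (S ((T ^^ (m + b)) x)) = S ((T ^^ b) x)"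
  using AE_funpow[OF assms]
proof eventually_elim
  case (elim x)
  have "(T ^^ m) (S ((T ^^ (m + b)) x)) = S ((T ^^ b) x)" for m b
  proof (induction m)
    case (Suc m)
    have "(T ^^ Suc m) (S ((T ^^ (Suc m + b)) x)) = (T ^^ m) (T (S (T ((T ^^ (m + b)) x))))"
      by (simp add: funpow_swap1)
    also have "\<dots> = (T ^^ m) (S ((T ^^ (m + b)) x))" using elim by simp
    finally show ?case using Suc by simp
  qed simp
  then show ?case by blast
qed

text \<open>The measure-preserving map \<open>S\<close> composed with \<open>T ^^ (m + m')\<close>
  runs the orbit backwards: the visits at times 0, \<open>m\<close>, \<open>m + m'\<close> become
  visits at \<open>m + m'\<close>, \<open>m'\<close>, 0. So the gaps \<open>m\<close>,
  \<open>m'\<close> are interchanged.\<close>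

lemma measure_triple_returns_reversed:
  assumes S: "measure_preserving_map M S" and rev: "AE x in M. T (S (T x)) = S x"
    and E: "E \<in> sets M"
  defines "F \<equiv> {x \<in> space M. S x \<in> E}"
  shows "measure M {x \<in> space M. x \<in> F \<and> (T ^^ m) x \<in> F \<and> (T ^^ (m + m')) x \<in> F} =
    measure M {x \<in> space M. x \<in> E \<and> (T ^^ m') x \<in> E \<and> (T ^^ (m + m')) x \<in> E}"
    (is "measure M ?GF = measure M ?GE")
proof -
  let ?f = "\<lambda>x. S ((T ^^ (m + m')) x)"
  have f: "measure_preserving_map M ?f"
    by (rule measure_preserving_map_compose[OF S measure_preserving_map_funpow[OF T_mp]])
  have F: "F \<in> sets M"
    unfolding F_def by (rule measure_preserving_map_vimage_in_sets[OF S E])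
  have space_f: "g x \<in> space M" if "x \<in> space M" "measure_preserving_map M g" for x g
    by (rule measurable_space[OF measure_preserving_mapD(1)[OF that(2)] that(1)])
  note space_T = space_f[OF _ measure_preserving_map_funpow[OF T_mp]]
  have "AE x in M. x \<in> ?GF \<longleftrightarrow> x \<in> {x \<in> space M. ?f x \<in> ?GE}"
    using AE_reversed_funpow[OF rev] AE_space
  proof eventually_elim
    case (elim x)
    have eqs: "(T ^^ m') (?f x) = S ((T ^^ m) x)" "(T ^^ (m + m')) (?f x) = S x"
      using elim(1)[rule_format, of m' m] elim(1)[rule_format, of "m + m'" 0]
      by (simp_all only: add.commute[of m' m] add_0_right funpow_0)
    show ?case
      unfolding F_def mem_Collect_eq eqs
      using elim(2) space_T[OF elim(2)] space_f[OF elim(2) f] by blast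
  qed
  then have "measure M ?GF = measure M {x \<in> space M. ?f x \<in> ?GE}"
  proof (rule finite_measure_eq_AE)
    show "?GF \<in> sets M" by (rule triple_returns_in_sets[OF F])
    show "{x \<in> space M. ?f x \<in> ?GE} \<in> sets M"
      by (rule measure_preserving_map_vimage_in_sets[OF f triple_returns_in_sets[OF E]])
  qed
  then show ?thesis
    by (rule trans[OF _ measure_preserving_map_vimage[OF f triple_returns_in_sets[OF E]]])
qed

end

section \<open>Return patterns in a block of two consecutive stages\<close>

locale flat_stair_block = rank_one +
  fixes n h :: nat
  assumes h_ge_2: "2 \<le> h" and r_n: "r n = 2 * h"
    and s_n_0: "1 \<le> i \<Longrightarrow> i \<le> h \<Longrightarrow> s n i = 0"
    and s_n_1: "h + 1 \<le> i \<Longrightarrow> i \<le> 2 * h \<Longrightarrow> s n i = 1"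
    and s_Suc_0: "1 \<le> i \<Longrightarrow> i \<le> r (Suc n) div 2 \<Longrightarrow> s (Suc n) i = 0"
    and s_Suc_1: "r (Suc n) div 2 + 1 \<le> i \<Longrightarrow> i \<le> r (Suc n) \<Longrightarrow> s (Suc n) i = 1"
begin

text \<open>The times encode a first return over two spacers and a second over one. Inside tower
  \<open>n + 2\<close>, two spacers are met only on entering a new subcolumn of tower
  \<open>n + 1\<close>, and the subcolumn of tower \<open>n\<close> reached there carries none. So
  in every case some return to \<open>F'\<close> comes one or two steps before a prescribed visit,
  against \<open>F1\<close> or \<open>F2\<close> unless the point is then in
  \<open>F' - F\<close>.\<close>

lemma triple_returns_upper:
  assumes F: "F \<in> sets M"
    and F1: "AE x in M. \<not> (x \<in> F \<and> T x \<in> F)"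
    and F2: "AE x in M. \<not> (x \<in> F \<and> T (T x) \<in> F)"
    and J: "J \<subseteq> {1..q n}"
  defines "F' \<equiv> \<Union>j\<in>J. lev n j"
  shows "measure M {x \<in> space M. x \<in> F \<and> (T ^^ (q n + 2)) x \<in> F \<and> (T ^^ (2 * q n + 3)) x \<in> F}
    \<le> measure M (F - F') + 3 * measure M (F' - F) + 1 / real (r (Suc n))" (is "measure M ?G \<le> _")
proof -
  let ?r' = "r (Suc n)"
  let ?P = "\<lambda>m. {x \<in> space M. (T ^^ m) x \<in> F' - F}"
  \<comment> \<open>In the last subcolumn of tower \<open>n + 1\<close> the next copies may lie
    beyond the top of tower \<open>n + 2\<close>; these points are counted as an error.\<close>
  define B where
    "B = (\<Union>(j, i)\<in>J \<times> {1..r n}. lev (Suc (Suc n)) (pos n ?r' i j))"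
  have finJ: "finite J" using J by (rule finite_subset) simp
  have r': "?r' \<in> {1..?r'}" using r_ge_2[of "Suc n"] by auto
  have F': "F' \<in> sets M" unfolding F'_def by (rule UN_lev_in_sets[OF J])
  have B_lev: "lev (Suc (Suc n)) (pos n ?r' i j) \<in> sets M"
    "measure M (lev (Suc (Suc n)) (pos n ?r' i j)) = w (Suc (Suc n))"
    if "(j, i) \<in> J \<times> {1..r n}" for i j
    using that J pos_bounds[OF r', of i j] lev_in_sets measure_lev by auto
  have B: "B \<in> sets M"
    unfolding B_def using finJ B_lev(1) by (intro sets.finite_UN) auto
  have P: "?P m \<in> sets M" "measure M (?P m) = measure M (F' - F)" for m
    using vimage_funpow_in_sets[of "F' - F" m] measure_vimage_funpow[of "F' - F" m] F F' by auto
  have "measure M B \<le> (\<Sum>(j, i)\<in>J \<times> {1..r n}. measure M (lev (Suc (Suc n)) (pos n ?r' i j)))"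
    unfolding B_def case_prod_beta
    using finJ B_lev(1) by (intro finite_measure_subadditive_finite) auto
  also have "\<dots> = (\<Sum>(j, i)\<in>J \<times> {1..r n}. w (Suc (Suc n)))"
    by (intro sum.cong refl) (use B_lev(2) in auto)
  also have "\<dots> = real (card J) * w n / real ?r'"
    using r_ge_2[of n] by (simp add: w_Suc card_cartesian_product)
  also have "\<dots> = measure M F' / real ?r'"
    unfolding F'_def measure_UN_lev[OF J] ..
  also have "\<dots> \<le> 1 / real ?r'"
    by (intro divide_right_mono) auto
  finally have mB: "measure M B \<le> 1 / real ?r'" .
  have "AE x in M. x \<in> ?G \<longrightarrow>
    x \<in> (F - F') \<union> B \<union> ?P (q n) \<union> ?P (q n + 1) \<union> ?P (2 * q n + 2)"
    using AE_regular_orbit AE_funpow[OF F1] AE_funpow[OF F2]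
  proof eventually_elim
    case (elim x)
    show ?case
    proof (intro impI, rule ccontr)
      assume G: "x \<in> ?G"
        and neg: "x \<notin> (F - F') \<union> B \<union> ?P (q n) \<union> ?P (q n + 1) \<union> ?P (2 * q n + 2)"
      then have "x \<in> F'" by auto
      then obtain j where j: "j \<in> J" "x \<in> lev n j" by (auto simp: F'_def)
      then have jq: "j \<in> {1..q n}" using J by auto
      from lev_pos_cover[OF j(2) jq] obtain i' i where
        i': "i' \<in> {1..?r'}" and i: "i \<in> {1..r n}" and
        x: "x \<in> lev (Suc (Suc n)) (pos n i' i j)" .
      have "i' \<noteq> ?r'" using neg j i x by (auto simp: B_def)
      then have i'2: "Suc i' \<in> {1..?r'}" using i' by auto
      have ret: "(T ^^ m) x \<in> F'" if "k' \<in> {1..?r'}" "k \<in> {1..r n}"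
        "pos n k' k j = pos n i' i j + m" for k' k m
        using return_same_level[OF elim(1) x i' i jq that] j by (auto simp: F'_def)
      have G2: "(T ^^ (q n + 2)) x \<in> F" "(T ^^ (2 * q n + 3)) x \<in> F" using G by auto
      \<comment> \<open>The times \<open>q n\<close> and \<open>q n + 1\<close> are two steps and
        one step before \<open>q n + 2\<close>, and \<open>2 * q n + 2\<close> is one step before
        \<open>2 * q n + 3\<close>. Outside the error sets a visit to \<open>F'\<close> is a visit
        to \<open>F\<close>, too close to the next one.\<close>
      have nz: "(T ^^ q n) x \<notin> F'"
      proof
        assume "(T ^^ q n) x \<in> F'"
        with neg G have "(T ^^ q n) x \<in> F" by auto
        with elim(3) G2(1) show False by (auto simp: add.commute[of "q n"] numeral_2_eq_2)
      qed
      have no: "(T ^^ (q n + 1)) x \<notin> F'"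
      proof
        assume "(T ^^ (q n + 1)) x \<in> F'"
        with neg G have "(T ^^ (q n + 1)) x \<in> F" by auto
        with elim(2)[rule_format, of "q n + 1"] G2(1) show False by (simp add: numeral_2_eq_2)
      qed
      have nt: "(T ^^ (2 * q n + 2)) x \<notin> F'"
      proof
        assume "(T ^^ (2 * q n + 2)) x \<in> F'"
        with neg G have *: "(T ^^ (2 * q n + 2)) x \<in> F" by auto
        have "T ((T ^^ (2 * q n + 2)) x) \<in> F"
          using G2(2) by (simp add: eval_nat_numeral)
        with elim(2) * show False by blast
      qed
      show False
      proof (cases "i < r n")
        case True
        then have k: "Suc i \<in> {1..r n}" by auto
        have "s n i = 0 \<or> s n i = 1"
          using s_n_0[of i] s_n_1[of i] i r_n by fastforce
        then show False
          using ret[OF i' k pos_Suc] i nz no by auto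
      next
        case False
        then have i_eq: "i = r n" using i by simp
        have one: "1 \<in> {1..r n}" "Suc 1 \<in> {1..r n}" using r_ge_2[of n] by auto
        have top: "s n (r n) = 1" using s_n_1[of "r n"] r_n h_ge_2 by simp
        have bot: "s n 1 = 0" using s_n_0[of 1] h_ge_2 by simp
        have pt: "pos n (Suc i') 1 j = pos n i' i j + (q n + 1 + s (Suc n) i')"
          using pos_top[of i' n j] i' i_eq top by simp
        consider "s (Suc n) i' = 0" | "s (Suc n) i' = 1"
          using s_Suc_0[of i'] s_Suc_1[of i'] i' by fastforce
        then show False
        proof cases
          case 1
          then show False using ret[OF i'2 one(1) pt] no by simp
        next
          case 2
          \<comment> \<open>Two spacers and then none: the second return comes one step too
            early.\<close>
          have "pos n (Suc i') (Suc 1) j = pos n i' i j + (2 * q n + 2)"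
            using pos_Suc[of 1 n "Suc i'" j] pt 2 bot by simp
          then show False using ret[OF i'2 one(2)] nt by blast
        qed
      qed
    qed
  qed
  then have "measure M ?G \<le>
    measure M ((F - F') \<union> B \<union> ?P (q n) \<union> ?P (q n + 1) \<union> ?P (2 * q n + 2))"
    by (rule finite_measure_mono_AE) (intro sets.Un sets.Diff F F' B P(1))
  also have "\<dots> \<le> measure M (F - F') + measure M B + measure M (?P (q n))
      + measure M (?P (q n + 1)) + measure M (?P (2 * q n + 2))"
    by (intro order_trans[OF measure_Un_le] add_right_mono order_refl sets.Un sets.Diff F F' B P(1))
  finally show ?thesis using mB unfolding P(2) by linarith
qed

text \<open>The times encode a return over one spacer followed by a return over two. A point does
  this if it starts in the last but one subcolumn of tower \<open>n\<close> and in the upper half of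
  the subcolumns of tower \<open>n + 1\<close>, the last one excepted. This is a fixed proportion of
  every level.\<close>

lemma triple_returns_lower:
  assumes E: "E \<in> sets M" and J: "J \<subseteq> {1..q n}" and r_Suc: "4 \<le> r (Suc n)"
  defines "E' \<equiv> \<Union>j\<in>J. lev n j"
  shows "measure M E' / (4 * real (r n)) - 3 * measure M (E' - E) \<le>
    measure M {x \<in> space M. x \<in> E \<and> (T ^^ (q n + 1)) x \<in> E \<and> (T ^^ (2 * q n + 3)) x \<in> E}"
    (is "_ \<le> measure M ?G")
proof -
  let ?r' = "r (Suc n)"
  let ?P = "\<lambda>m. {x \<in> space M. (T ^^ m) x \<in> E' - E}"
  \<comment> \<open>The last but one subcolumn; as \<open>h\<close> is at least 2, it lies in the
    half that carries spacers.\<close>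
  let ?i = "2 * h - 1"
  define c where "c = ?r' div 2"
  \<comment> \<open>There are \<open>k\<close> admissible subcolumns, \<open>c + 1\<close> up to
    \<open>?r' - 1\<close>. Their copies of level \<open>j\<close> are adjacent and form one
    interval, starting at \<open>b j\<close> and of length \<open>v\<close>.\<close>
  define k where "k = ?r' - 1 - c"
  define b where "b j = a n j + (real ?i - 1) * w (Suc n) + real c * w (Suc (Suc n))" for j
  define v where "v = real k * w (Suc (Suc n))"
  define L where "L = (\<Union>j\<in>J. {b j ..< b j + v})"
  have v0: "0 \<le> v" using w_pos[of "Suc (Suc n)"] by (simp add: v_def)
  have i: "?i \<in> {1..r n}" using r_n h_ge_2 by auto
  have E': "E' \<in> sets M" unfolding E'_def by (rule UN_lev_in_sets[OF J])
  have L_pos: "\<exists>i'\<in>{c + 1..?r' - 1}. x \<in> lev (Suc (Suc n)) (pos n i' ?i j)"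
    if "j \<in> {1..q n}" "x \<in> {b j ..< b j + v}" for x j
  proof -
    from interval_subdivide[OF w_pos that(2)[unfolded v_def]] obtain l where
      l: "l \<in> {1..k}" "x \<in> {b j + (real l - 1) * w (Suc (Suc n)) ..< b j + real l * w (Suc (Suc n))}"
      by blast
    have "c + l \<in> {1..?r'}" using l(1) by (auto simp: k_def)
    from lev_pos_eq[OF this i that(1)] l(2)
    have "x \<in> lev (Suc (Suc n)) (pos n (c + l) ?i j)"
      by (simp add: b_def algebra_simps)
    moreover have "c + l \<in> {c + 1..?r' - 1}" using l(1) by (auto simp: k_def)
    ultimately show ?thesis by blast
  qed
  have L_lev: "{b j ..< b j + v} \<subseteq> lev n j" if "j \<in> {1..q n}" for j
  proof
    fix x assume "x \<in> {b j ..< b j + v}"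
    from L_pos[OF that this] obtain i' where
      "i' \<in> {c + 1..?r' - 1}" "x \<in> lev (Suc (Suc n)) (pos n i' ?i j)" by blast
    moreover from this have "i' \<in> {1..?r'}" using diff_le_self[of ?r' 1] by fastforce
    ultimately show "x \<in> lev n j" using lev_pos_subset[OF _ i that, of i'] by blast
  qed
  have L: "L \<in> sets M"
    unfolding L_def using interval_in_sets[OF L_lev] J
    by (intro sets.finite_UN) (auto intro: finite_subset)
  have P: "?P m \<in> sets M" "measure M (?P m) = measure M (E' - E)" for m
    using vimage_funpow_in_sets[of "E' - E" m] measure_vimage_funpow[of "E' - E" m] E E' by auto
  have G: "?G \<in> sets M" by (rule triple_returns_in_sets[OF E])
  have "AE x in M. x \<in> L \<longrightarrow> x \<in> ?G \<union> ?P 0 \<union> ?P (q n + 1) \<union> ?P (2 * q n + 3)"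
    using AE_regular_orbit AE_space
  proof eventually_elim
    case (elim x)
    show ?case
    proof
      assume "x \<in> L"
      then obtain j where j: "j \<in> J" "x \<in> {b j ..< b j + v}" by (auto simp: L_def)
      then have jq: "j \<in> {1..q n}" using J by auto
      from L_pos[OF jq j(2)] obtain i' where
        i': "i' \<in> {c + 1..?r' - 1}" and x: "x \<in> lev (Suc (Suc n)) (pos n i' ?i j)" by blast
      then have i'1: "i' \<in> {1..?r'}" and i'2: "Suc i' \<in> {1..?r'}" by auto
      have spacers: "s n ?i = 1" "s n (r n) = 1" "s (Suc n) i' = 1"
        using s_n_1[of ?i] s_n_1[of "r n"] s_Suc_1[of i'] i' h_ge_2 r_n by (auto simp: c_def)
      have ret: "(T ^^ m) x \<in> E'" if "k' \<in> {1..?r'}" "k \<in> {1..r n}"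
        "pos n k' k j = pos n i' ?i j + m" for k' k m
        using return_same_level[OF elim(1) x i'1 i jq that] j by (auto simp: E'_def)
      have SucI: "Suc ?i = r n" using h_ge_2 r_n by simp
      have p1: "pos n i' (r n) j = pos n i' ?i j + (q n + 1)"
        using pos_Suc[of ?i n i' j] SucI spacers i by simp
      have p2: "pos n (Suc i') 1 j = pos n i' ?i j + (2 * q n + 3)"
        using pos_top[of i' n j] p1 spacers i'1 by simp
      have rn: "r n \<in> {1..r n}" "1 \<in> {1..r n}" using r_ge_2[of n] by auto
      have "(T ^^ 0) x \<in> E'" using ret[OF i'1 i, of 0] by simp
      moreover have "(T ^^ (q n + 1)) x \<in> E'" using ret[OF i'1 rn(1) p1] .
      moreover have "(T ^^ (2 * q n + 3)) x \<in> E'" using ret[OF i'2 rn(2) p2] .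
      ultimately show "x \<in> ?G \<union> ?P 0 \<union> ?P (q n + 1) \<union> ?P (2 * q n + 3)"
        using elim(2) by auto
    qed
  qed
  then have "measure M L \<le> measure M (?G \<union> ?P 0 \<union> ?P (q n + 1) \<union> ?P (2 * q n + 3))"
    by (rule finite_measure_mono_AE) (intro sets.Un G P(1))
  also have "\<dots> \<le> measure M ?G + measure M (?P 0) + measure M (?P (q n + 1))
      + measure M (?P (2 * q n + 3))"
    by (intro order_trans[OF measure_Un_le] add_right_mono order_refl sets.Un G P(1))
  finally have 1: "measure M L - 3 * measure M (E' - E) \<le> measure M ?G" unfolding P(2) by linarith
  have "real ?r' / 4 \<le> real k"
  proof -
    \<comment> \<open>Equality holds at \<open>?r' = 4\<close>, where \<open>c = 2\<close> and
      \<open>k = 1\<close>.\<close>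
    have "?r' \<le> 4 * k" using r_Suc by (auto simp: k_def c_def)
    then show ?thesis by linarith
  qed
  then have "real ?r' / 4 * (w n / (real (r n) * real ?r')) \<le> v"
    unfolding v_def using w_pos[of n] by (intro mult_mono) (auto simp: w_Suc)
  then have "w n / (4 * real (r n)) \<le> v" using r_Suc by simp
  then have "real (card J) * (w n / (4 * real (r n))) \<le> real (card J) * v"
    by (intro mult_left_mono) auto
  also have "\<dots> = measure M L"
    unfolding L_def using J by (intro measure_UN_intervals[OF J L_lev v0, symmetric]) auto
  finally have "measure M E' / (4 * real (r n)) \<le> measure M L"
    unfolding E'_def measure_UN_lev[OF J] by simp
  with 1 show ?thesis by simp
qed

end

section \<open>The contradiction\<close>

lemma reversible_imp_reversed:
  assumes "reversible M T"
  obtains S where "measure_preserving_map M S" "AE x in M. T (S (T x)) = S x"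
proof -
  from assms obtain T' S where inv: "mutually_inverse_mod0 M T T'" and S: "automorphism M S"
    and TS: "AE x in M. T (S x) = S (T' x)"
    by (auto simp: reversible_def)
  have T: "measure_preserving_map M T" and T': "AE x in M. T' (T x) = x"
    using inv by (auto simp: mutually_inverse_mod0_def)
  have "measure_preserving_map M S"
    using S by (auto simp: automorphism_def mutually_inverse_mod0_def)
  \<comment> \<open>Evaluating the conjugacy at \<open>T x\<close> removes the inverse
    \<open>T'\<close>.\<close>
  moreover have "AE x in M. T (S (T x)) = S x"
    using measure_preserving_map_AE[OF T TS] T' by eventually_elim simp
  ultimately show thesis by (rule that)
qed

theorem theorem7p2:
  fixes r :: "nat \<Rightarrow> nat" and s :: "nat \<Rightarrow> nat \<Rightarrow> nat"
    and M :: "real measure" and T :: "real \<Rightarrow> real"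
    and R :: nat and nk :: "nat \<Rightarrow> nat"
  assumes "\<And>n. 2 \<le> r n"
    and "rank_one_automorphism r s M T"
    and "even R" and "4 \<le> R"
    and "strict_mono nk"
    and "\<And>k. r (nk k) = R"
    and "filterlim (\<lambda>k. r (nk k + 1)) at_top sequentially"
    and "\<And>k i. 1 \<le> i \<Longrightarrow> i \<le> R div 2 \<Longrightarrow> s (nk k) i = 0"
    and "\<And>k i. R div 2 + 1 \<le> i \<Longrightarrow> i \<le> R \<Longrightarrow> s (nk k) i = 1"
    and "\<And>k i. 1 \<le> i \<Longrightarrow> i \<le> r (nk k + 1) div 2 \<Longrightarrow> s (nk k + 1) i = 0"
    and "\<And>k i. r (nk k + 1) div 2 + 1 \<le> i \<Longrightarrow> i \<le> r (nk k + 1) \<Longrightarrow> s (nk k + 1) i = 1"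
  shows "\<not> reversible M T"
proof
  assume "reversible M T"
  then obtain S where S: "measure_preserving_map M S" and rev: "AE x in M. T (S (T x)) = S x"
    by (rule reversible_imp_reversed)
  from assms(2) obtain q a w where cs: "cutting_and_stacking r s q a w"
    and M: "M = restrict_space lborel (tower_union q a w)" and "prob_space M"
    and aut: "automorphism M T"
    and Tl: "AE x in M. \<forall>n. \<forall>j\<in>{1..<q n}. x \<in> level a w n j \<longrightarrow> T x = x + (a n (Suc j) - a n j)"
    by (auto simp: rank_one_automorphism_def)
  interpret prob_space M by fact
  interpret rank_one M r s q a w T
    by unfold_locales (use assms(1) cs M Tl aut in
      \<open>auto simp: automorphism_def mutually_inverse_mod0_def\<close>)
  obtain E where E: "E \<in> sets M" "0 < measure M E"
    "AE x in M. \<not> (x \<in> E \<and> T x \<in> E)" "AE x in M. \<not> (x \<in> E \<and> T (T x) \<in> E)"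
    by (rule exists_disjoint_translates)
  define F where "F = {x \<in> space M. S x \<in> E}"
  have F: "F \<in> sets M"
    unfolding F_def by (rule measure_preserving_map_vimage_in_sets[OF S E(1)])
  \<comment> \<open>\<open>T\<close> maps \<open>S (T x)\<close> to \<open>S x\<close>, and its
    square maps \<open>S (T (T x))\<close> to \<open>S x\<close>. So close visits of
    \<open>x\<close> to \<open>F\<close> are close visits to \<open>E\<close> in reverse
    order.\<close>
  note ST = measure_preserving_map_compose[OF S measure_preserving_map_funpow[OF T_mp]]
  have F1: "AE x in M. \<not> (x \<in> F \<and> T x \<in> F)"
    using measure_preserving_map_AE[OF ST[of 1] E(3)] rev
    by eventually_elim (auto simp: F_def)
  have F2: "AE x in M. \<not> (x \<in> F \<and> T (T x) \<in> F)"
    using measure_preserving_map_AE[OF ST[of 2] E(4)] AE_reversed_funpow[OF rev]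
  proof eventually_elim
    case (elim x)
    then show ?case using elim(2)[rule_format, of 2 0] by (auto simp: F_def numeral_2_eq_2)
  qed
  \<comment> \<open>With this choice \<open>measure M E / (4 * real R)\<close> is
    \<open>10 * e\<close>. The lower bound then exceeds \<open>10 * e - e - 3 * e = 6 * e\<close>,
    while the upper bound is below \<open>e + 3 * e + e = 5 * e\<close>.\<close>
  define e where "e = measure M E / (40 * real R)"
  have e: "0 < e" using E(2) assms(4) by (simp add: e_def)
  have nk: "filterlim nk sequentially sequentially"
    using assms(5) by (rule filterlim_subseq)
  have "\<forall>\<^sub>F k in sequentially. False"
    using eventually_compose_filterlim[OF approx_by_levels[OF E(1) e] nk]
      eventually_compose_filterlim[OF approx_by_levels[OF F e] nk]
      filterlim_at_top[THEN iffD1, OF assms(7), rule_format, of 4]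
      filterlim_at_top_dense[THEN iffD1, OF filterlim_compose[OF filterlim_real_sequentially assms(7)],
        rule_format, of "1 / e"]
  proof eventually_elim
    case (elim k)
    \<comment> \<open>Here \<open>h\<close> is \<open>R div 2\<close>, so \<open>2 * h = R\<close>
      by evenness and \<open>h\<close> is at least 2.\<close>
    interpret flat_stair_block M r s q a w T "nk k" "R div 2"
      using assms(3,4,6) assms(8-11)[where k=k] by unfold_locales auto
    obtain J where J: "J \<subseteq> {1..q (nk k)}"
      "measure M (E - (\<Union>j\<in>J. lev (nk k) j)) < e" "measure M ((\<Union>j\<in>J. lev (nk k) j) - E) < e"
      using elim(1) by blast
    obtain K where K: "K \<subseteq> {1..q (nk k)}"
      "measure M (F - (\<Union>j\<in>K. lev (nk k) j)) < e" "measure M ((\<Union>j\<in>K. lev (nk k) j) - F) < e"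
      using elim(2) by blast
    let ?E' = "\<Union>j\<in>J. lev (nk k) j"
    have E': "?E' \<in> sets M" by (rule UN_lev_in_sets[OF J(1)])
    have "measure M E \<le> measure M (?E' \<union> (E - ?E'))"
      using E(1) E' by (intro finite_measure_mono) auto
    also have "\<dots> \<le> measure M ?E' + measure M (E - ?E')"
      using E(1) E' by (intro measure_Un_le) auto
    finally have mE: "measure M E - e \<le> measure M ?E'" using J(2) by simp
    have "1 / real (r (nk k + 1)) < e"
      using elim(3,4) e by (simp add: field_simps)
    \<comment> \<open>The gaps \<open>q + 2\<close>, \<open>q + 1\<close> for \<open>F\<close>
      correspond to \<open>q + 1\<close>, \<open>q + 2\<close> for \<open>E\<close>, where
      \<open>q\<close> is the height of tower \<open>nk k\<close>; so the two bounds concern the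
      same measure.\<close>
    then have "measure M ?E' / (4 * real R) - 3 * e \<le> 5 * e"
      using triple_returns_lower[OF E(1) J(1)] triple_returns_upper[OF F F1 F2 K(1)]
        measure_triple_returns_reversed[OF S rev E(1), of "q (nk k) + 2" "q (nk k) + 1"]
        elim(3) J(3) K(2,3) assms(6)[of k]
      by (simp add: F_def[symmetric] mult_2 eval_nat_numeral)
    moreover have "(measure M E - e) / (4 * real R) \<le> measure M ?E' / (4 * real R)"
      using mE by (intro divide_right_mono) auto
    moreover have "measure M E / (4 * real R) = 10 * e" by (simp add: e_def)
    moreover have "e / (4 * real R) < e"
      using e assms(4) by (simp add: field_simps)
    ultimately show False using e unfolding diff_divide_distrib by linarith
  qed
  then show False by simp
qed

end
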